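(* Let $n>2$ and let $\mathcal{M}=\{X\in \mathrm{Sym}(n)\mid \mathrm{discr}(X)=0\}$ be the discriminant surface, i.e. the set of all real symmetric $n\times n$ matrices having a multiple eigenvalue. Then $\mathcal{M}$ is algebraically irreducible, that is, $\mathcal{M}$ is not a union of two algebraic subsets of $\mathrm{Sym}(n)$ both different from $\mathcal{M}$.
   Context: $\mathrm{Sym}(n)=\mathrm{Sym}(n,\mathbb{R})$ is the real vector space of symmetric $n\times n$ real matrices, of dimension $n(n+1)/2$. $\mathrm{discr}(X)$ is the discriminant of the characteristic polynomial of $X$; it is a polynomial in the entries of $X$. An algebraic set in $\mathrm{Sym}(n)$ is the common zero set in $\mathrm{Sym}(n)$ of a finite family of polynomials with real coefficients in the matrix entries (everything is over the field $\mathbb{R}$ of real numbers). *)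

theory Defs
  imports "Subresultants.Resultant_Prelim" "HOL-Analysis.Analysis"
begin

(* Jordan_Normal_Form (below Resultant_Prelim) has its own matrix type, used here only
   inside resultant. All matrices below are of the HOL-Analysis type. *)
no_notation Matrix.vec_index (infixl "$" 100)
hide_const (open) Matrix.mat Matrix.vec Determinant.det

definition Sym :: "(real ^ 'n ^ 'n) set" where
  "Sym = {X. transpose X = X}"

(* det (x I - X), over the ring real poly with x = [:0, 1:] *)
definition charpoly :: "real ^ 'n ^ 'n \<Rightarrow> real poly" where
  "charpoly X = det (mat [:0, 1:] - map_matrix (\<lambda>c. [:c:]) X)"

(* The usual discriminant a^(2d-2) * (PROD i<j. (r_i - r_j)^2) of a polynomial of degree
   d > 0 with leading coefficient a and complex roots r_1, ..., r_d. *)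
definition poly_discriminant :: "'a::field poly \<Rightarrow> 'a" where
  "poly_discriminant p =
     (- 1) ^ (degree p * (degree p - 1) div 2) * resultant p (pderiv p) / lead_coeff p"

definition discr :: "real ^ 'n ^ 'n \<Rightarrow> real" where
  "discr X = poly_discriminant (charpoly X)"

definition discriminant_surface :: "(real ^ 'n ^ 'n) set" where
  "discriminant_surface = {X \<in> Sym. discr X = 0}"

definition has_multiple_eigenvalue :: "real ^ 'n ^ 'n \<Rightarrow> bool" where
  "has_multiple_eigenvalue X \<longleftrightarrow> (\<exists>e. order e (charpoly X) \<ge> 2)"

(* A real_polynomial_function on real ^ 'n ^ 'n is obtained from constants and linear forms
   by sums and products. Linear forms are the linear combinations of the entries X $ i $ j,
   so these are exactly the functions given by real polynomials in the matrix entries. *)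
definition algebraic_in_Sym :: "(real ^ 'n ^ 'n) set \<Rightarrow> bool" where
  "algebraic_in_Sym A \<longleftrightarrow>
     (\<exists>F. finite F \<and> (\<forall>f\<in>F. real_polynomial_function f) \<and> A = {X \<in> Sym. \<forall>f\<in>F. f X = 0})"

definition algebraically_irreducible :: "(real ^ 'n ^ 'n) set \<Rightarrow> bool" where
  "algebraically_irreducible M \<longleftrightarrow>
     \<not> (\<exists>A B. algebraic_in_Sym A \<and> algebraic_in_Sym B \<and> A \<noteq> M \<and> B \<noteq> M \<and> M = A \<union> B)"

end

(* The discriminant surface is the image of a vector space under a polynomial map. A symmetric
   matrix X has a multiple eigenvalue e iff there are linearly independent u, v with
   X u = e u and X v = e v, that is, iff X = e I + P S P with S symmetric and P the orthogonal
   projection onto the complement of u, v. The Gram determinant of u, v times this projection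
   is polynomial in u and v, and it vanishes when u, v are dependent, so using it in place
   of P does not leave the surface. If f and g are polynomials that do not vanish identically
   on the surface, restrict f and g to a line in the parameter space that joins a point with
   f \<noteq> 0 to a point with g \<noteq> 0: the restrictions are nonzero polynomials in one variable, so
   f g does not vanish identically. *)
theory Submission
  imports Defs "Subresultants.Subresultant_Gcd" "HOL-Computational_Algebra.Field_as_Ring"
    "HOL-Computational_Algebra.Fundamental_Theorem_Algebra"
begin

(* The additional imports bring the Jordan_Normal_Form names and notation back into scope. *)
no_notation Matrix.vec_index (infixl "$" 100)
no_notation scalar_prod (infix "\<bullet>" 70)
hide_const (open) Matrix.mat Matrix.vec Determinant.det

section \<open>Characteristic polynomials of symmetric matrices\<close>

text \<open>By the Leibniz formula the determinant is an integer polynomial in the entries. This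
  gives evaluation of \<open>charpoly\<close> at real and at complex points.\<close>

lemma comm_ring_hom_det:
  assumes "comm_ring_hom h"
  shows "h (det (mat a - B)) = det (mat (h a) - map_matrix h B)"
proof -
  interpret comm_ring_hom h by fact
  show ?thesis
    by (simp add: det_def hom_sum hom_mult hom_prod hom_of_int map_matrix_def mat_def hom_minus
        if_distrib[of h] cong: if_cong)
qed

lemma poly_charpoly: "poly (charpoly X) x = det (mat x - X)"
proof -
  have h: "comm_ring_hom (\<lambda>p. poly p x)"
    by unfold_locales auto
  show ?thesis
    unfolding charpoly_def by (subst comm_ring_hom_det[OF h]) (simp add: map_matrix_def)
qed

lemma map_poly_complex_of_real_mult:
  "map_poly complex_of_real (p * q) = map_poly complex_of_real p * map_poly complex_of_real q"
proof -
  interpret map_poly_comm_ring_hom complex_of_real ..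
  show ?thesis by (rule hom_mult)
qed

lemma poly_charpoly_complex:
  "poly (map_poly complex_of_real (charpoly X)) z = det (mat z - map_matrix complex_of_real X)"
proof -
  have h: "comm_ring_hom (\<lambda>p. poly (map_poly complex_of_real p) z)"
    by unfold_locales (auto simp: hom_distribs map_poly_complex_of_real_mult)
  show ?thesis
    unfolding charpoly_def by (subst comm_ring_hom_det[OF h]) (simp add: map_matrix_def hom_distribs)
qed

lemma det_eq_0_iff_kernel:
  fixes A :: "'a::field^'n^'n"
  shows "det A = 0 \<longleftrightarrow> (\<exists>w. w \<noteq> 0 \<and> A *v w = 0)"
  using invertible_det_nz[of A] invertible_left_inverse[of A] matrix_left_invertible_ker[of A]
  by auto

lemma mat_mult_vec:
  fixes c :: "'a::comm_semiring_1"
  shows "mat c *v w = c *s w"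
  by (simp add: vec_eq_iff matrix_vector_mult_def mat_def if_distrib[of "\<lambda>y. y * _"] cong: if_cong)

lemma root_charpoly_iff:
  "poly (charpoly X) e = 0 \<longleftrightarrow> (\<exists>u. norm u = 1 \<and> X *v u = e *\<^sub>R u)"
proof
  assume "poly (charpoly X) e = 0"
  then obtain w where w: "w \<noteq> 0" "(mat e - X) *v w = 0"
    unfolding poly_charpoly det_eq_0_iff_kernel by blast
  then have "X *v w = e *\<^sub>R w"
    by (simp add: matrix_vector_mult_diff_rdistrib mat_mult_vec scalar_mult_eq_scaleR)
  with w show "\<exists>u. norm u = 1 \<and> X *v u = e *\<^sub>R u"
    by (intro exI[of _ "w /\<^sub>R norm w"]) (simp add: matrix_vector_mult_scaleR)
next
  assume "\<exists>u. norm u = 1 \<and> X *v u = e *\<^sub>R u"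
  then obtain u where "norm u = 1" "X *v u = e *\<^sub>R u" by blast
  then have "u \<noteq> 0" "(mat e - X) *v u = 0"
    by (auto simp: matrix_vector_mult_diff_rdistrib mat_mult_vec scalar_mult_eq_scaleR)
  then show "poly (charpoly X) e = 0"
    unfolding poly_charpoly det_eq_0_iff_kernel by blast
qed

text \<open>Otherwise every real number would be an eigenvalue, while eigenvalues are bounded by the
  operator norm.\<close>

lemma charpoly_nonzero: "charpoly X \<noteq> 0"
proof
  assume "charpoly X = 0"
  define e where "e = onorm ((*v) X) + 1"
  obtain u where u: "norm u = 1" "X *v u = e *\<^sub>R u"
    using root_charpoly_iff[of X e] \<open>charpoly X = 0\<close> by auto
  have "\<bar>e\<bar> \<le> onorm ((*v) X)"
    using onorm[OF matrix_vector_mul_bounded_linear[of X], of u] u by simp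
  then show False by (simp add: e_def)
qed

section \<open>Reality of the eigenvalues and the discriminant criterion\<close>

lemma Sym_inner: "X \<in> Sym \<Longrightarrow> (X *v x) \<bullet> y = x \<bullet> (X *v y)"
  by (metis (mono_tags, lifting) Sym_def dot_lmul_matrix mem_Collect_eq transpose_matrix_vector)

text \<open>Split a complex eigenvector as \<open>x + i y\<close>. Symmetry equates the inner
  products of \<open>X x\<close> with \<open>y\<close> and of \<open>x\<close> with
  \<open>X y\<close>, and their difference is \<open>Im z\<close> times the squared length of the
  eigenvector.\<close>

lemma charpoly_Sym_root_real:
  assumes X: "X \<in> Sym" and z: "poly (map_poly complex_of_real (charpoly X)) z = 0"
  shows "Im z = 0"
proof -
  obtain w where w: "w \<noteq> 0" "(mat z - map_matrix complex_of_real X) *v w = 0"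
    using z unfolding poly_charpoly_complex det_eq_0_iff_kernel by blast
  then have eq: "map_matrix complex_of_real X *v w = z *s w"
    by (simp add: matrix_vector_mult_diff_rdistrib mat_mult_vec)
  define x y where "x = (\<chi> i. Re (w $ i))" and "y = (\<chi> i. Im (w $ i))"
  have eqi: "(\<Sum>j\<in>UNIV. of_real (X $ i $ j) * w $ j) = z * w $ i" for i
    using eq by (simp add: vec_eq_iff matrix_vector_mult_def map_matrix_def)
  have Xx: "X *v x = Re z *\<^sub>R x - Im z *\<^sub>R y"
    using arg_cong[OF eqi, of Re] by (simp add: vec_eq_iff matrix_vector_mult_def x_def y_def)
  have Xy: "X *v y = Re z *\<^sub>R y + Im z *\<^sub>R x"
    using arg_cong[OF eqi, of Im] by (simp add: vec_eq_iff matrix_vector_mult_def x_def y_def)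
  have "x \<noteq> 0 \<or> y \<noteq> 0"
    using w(1) by (auto simp: vec_eq_iff x_def y_def complex_eq_iff)
  then have "x \<bullet> x + y \<bullet> y > 0"
    by (metis add_pos_nonneg add_nonneg_pos inner_ge_zero inner_gt_zero_iff)
  moreover have "Im z * (x \<bullet> x + y \<bullet> y) = 0"
    using Sym_inner[OF X, of x y] unfolding Xx Xy
    by (simp add: inner_simps inner_commute algebra_simps)
  ultimately show ?thesis by auto
qed

lemma discr_eq_0_iff:
  assumes X: "X \<in> Sym"
  shows "discr X = 0 \<longleftrightarrow> has_multiple_eigenvalue X"
proof -
  define p where "p = charpoly X"
  have p: "p \<noteq> 0" by (simp add: p_def charpoly_nonzero)
  define d where "d = gcd p (pderiv p)"
  have d: "d \<noteq> 0" "d dvd p" "d dvd pderiv p" using p by (auto simp: d_def)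
  \<comment> \<open>The sign and the leading coefficient are nonzero, so only the resultant can
    vanish, which means a nonconstant common factor of \<open>p\<close> and
    \<open>pderiv p\<close>.\<close>
  have "discr X = 0 \<longleftrightarrow> degree d \<noteq> 0"
    using p by (simp add: discr_def poly_discriminant_def resultant_0_gcd flip: p_def d_def)
  also have "\<dots> \<longleftrightarrow> (\<exists>e. poly d e = 0)"
  proof
    \<comment> \<open>A nonconstant real polynomial may lack real roots, so a root of
      \<open>d\<close> is taken over the complex numbers; it is also a root of \<open>p\<close>,
      hence real.\<close>
    assume "degree d \<noteq> 0"
    then have "\<not> constant (poly (map_poly complex_of_real d))"
      by (simp add: constant_degree)
    then obtain z where z: "poly (map_poly complex_of_real d) z = 0"
      using fundamental_theorem_of_algebra by blast
    then have "poly (map_poly complex_of_real p) z = 0"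
      using d(2) by (auto simp: map_poly_complex_of_real_mult elim!: dvdE)
    then have "z = of_real (Re z)"
      using charpoly_Sym_root_real[OF X, of z] by (simp add: p_def complex_eq_iff)
    then have "poly d (Re z) = 0"
      using z by (metis of_real_eq_0_iff of_real_hom.poly_map_poly)
    then show "\<exists>e. poly d e = 0" ..
  next
    assume "\<exists>e. poly d e = 0"
    then show "degree d \<noteq> 0" using d(1) degree_eq_zeroE[of d] by fastforce
  qed
  also have "\<dots> \<longleftrightarrow> (\<exists>e. poly p e = 0 \<and> poly (pderiv p) e = 0)"
    by (simp add: d_def poly_eq_0_iff_dvd)
  also have "\<dots> \<longleftrightarrow> (\<exists>e. order e p \<ge> 2)"
  proof -
    have "poly p e = 0 \<and> poly (pderiv p) e = 0 \<longleftrightarrow> order e p \<ge> 2" for e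
    proof (cases "poly p e = 0")
      case True
      then have o: "order e p \<noteq> 0" using p by (simp add: order_root)
      \<comment> \<open>A nonzero polynomial with a root is not constant; then differentiation
        lowers the order of that root by exactly one.\<close>
      have "pderiv p \<noteq> 0"
        using True p by (metis add.right_neutral degree_eq_zeroE mult_zero_right pCons_0_0
            pderiv_eq_0_iff poly_0 poly_pCons)
      then show ?thesis
        using True order_pderiv[of p e] o p by (auto simp: order_root)
    next
      case False
      then show ?thesis using p by (simp add: order_root)
    qed
    then show ?thesis by blast
  qed
  finally show ?thesis by (simp add: has_multiple_eigenvalue_def p_def)
qed

section \<open>Deflation of an eigenvector\<close>

definition outer :: "real^'n \<Rightarrow> real^'n \<Rightarrow> real^'n^'n" where
  "outer a b = (\<chi> i j. a $ i * b $ j)"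

lemma outer_mult_vec: "outer a b *v x = (b \<bullet> x) *\<^sub>R a"
  by (simp add: outer_def vec_eq_iff matrix_vector_mult_def inner_vec_def sum_distrib_left mult_ac)

text \<open>An orthogonal change of basis takes a coordinate vector to \<open>u\<close>; in that
  basis the matrix is diagonal with one entry \<open>1 - c\<close> and all others 1.\<close>

lemma det_mat_1_minus_outer:
  fixes u :: "real^'n"
  assumes "norm u = 1"
  shows "det (mat 1 - c *\<^sub>R outer u u) = 1 - c"
proof -
  fix k :: 'n
  obtain A where A: "orthogonal_matrix A" "A *v axis k 1 = u"
    using orthogonal_matrix_exists_basis[OF assms, of k] by blast
  define D where "D = mat 1 - c *\<^sub>R outer (axis k 1) (axis k 1 :: real^'n)"
  have AA: "A ** transpose A = mat 1" "transpose A ** A = mat 1"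
    using A by (auto simp: orthogonal_matrix_def)
  have "mat 1 - c *\<^sub>R outer u u = A ** D ** transpose A"
  proof (subst matrix_eq, rule allI)
    fix x
    have "u \<bullet> x = axis k 1 \<bullet> (transpose A *v x)"
      unfolding A(2)[symmetric] by (metis dot_lmul_matrix transpose_matrix_vector transpose_transpose)
    moreover have "A *v (transpose A *v x) = x"
      unfolding matrix_vector_mul_assoc AA by simp
    ultimately show "(mat 1 - c *\<^sub>R outer u u) *v x = A ** D ** transpose A *v x"
      by (simp add: D_def matrix_vector_mult_diff_rdistrib scaleR_matrix_vector_assoc[symmetric] outer_mult_vec
          A(2) matrix_vector_mult_diff_distrib matrix_vector_mult_scaleR flip: matrix_vector_mul_assoc)
  qed
  then have "det (mat 1 - c *\<^sub>R outer u u) = det A * det (transpose A) * det D"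
    by (simp add: det_mul)
  also have "det A * det (transpose A) = 1"
    using AA(1) by (metis det_mul det_I)
  also have "det D = (\<Prod>i\<in>UNIV. D $ i $ i)"
    by (rule det_diagonal) (auto simp: D_def outer_def mat_def axis_def)
  also have "\<dots> = (\<Prod>i\<in>UNIV. if i = k then 1 - c else 1)"
    by (rule prod.cong) (auto simp: D_def outer_def mat_def axis_def)
  finally show ?thesis by simp
qed

text \<open>With \<open>M = x I - X\<close> one has \<open>M u = (x - e) u\<close>, hence
  \<open>M - u u\<^sup>T = M (I - u u\<^sup>T / (x - e))\<close>; the last factor has determinant
  \<open>1 - 1 / (x - e)\<close>.\<close>

lemma charpoly_deflation:
  assumes u: "norm u = 1" "X *v u = e *\<^sub>R u"
  shows "[:- (e + 1), 1:] * charpoly X = [:- e, 1:] * charpoly (X + outer u u)"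
proof -
  \<comment> \<open>The extra factor \<open>x - e\<close> makes both sides vanish at
    \<open>x = e\<close>, where the factorization is undefined; it is cancelled at the end.\<close>
  have "poly ([:- e, 1:] * ([:- (e + 1), 1:] * charpoly X)) x =
      poly ([:- e, 1:] * ([:- e, 1:] * charpoly (X + outer u u))) x" for x
  proof (cases "x = e")
    case False
    define M where "M = mat x - X"
    have Mu: "M *v u = (x - e) *\<^sub>R u"
      by (simp add: M_def matrix_vector_mult_diff_rdistrib mat_mult_vec scalar_mult_eq_scaleR u
          algebra_simps)
    have "M - outer u u = M ** (mat 1 - (1 / (x - e)) *\<^sub>R outer u u)"
      unfolding matrix_eq using False
      by (simp add: matrix_vector_mult_diff_rdistrib outer_mult_vec scaleR_matrix_vector_assoc[symmetric] Mu
          matrix_vector_mult_diff_distrib matrix_vector_mult_scaleR flip: matrix_vector_mul_assoc)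
    moreover have "mat x - (X + outer u u) = M - outer u u"
      by (simp add: M_def)
    ultimately have "det (mat x - (X + outer u u)) = det M * (1 - 1 / (x - e))"
      by (simp add: det_mul det_mat_1_minus_outer[OF u(1)])
    then have "(x - e) * det (mat x - (X + outer u u)) = (x - (e + 1)) * det (mat x - X)"
      using False by (simp add: M_def field_simps)
    moreover have "poly [:- e, 1:] x = x - e" "poly [:- (e + 1), 1:] x = x - (e + 1)"
      by simp_all
    ultimately show ?thesis by (simp only: poly_mult poly_charpoly)
  qed simp
  then have "[:- e, 1:] * ([:- (e + 1), 1:] * charpoly X) =
      [:- e, 1:] * ([:- e, 1:] * charpoly (X + outer u u))"
    by (simp only: poly_eq_poly_eq_iff[symmetric]) blast
  then show ?thesis by (simp only: mult_cancel_left) simp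
qed

text \<open>Adding \<open>u u^T\<close> moves one copy of the eigenvalue \<open>e\<close> to
  \<open>e + 1\<close>. In the deflation identity the factor \<open>x - (e + 1)\<close> has order 0
  at \<open>e\<close>, and \<open>x - e\<close> has order 1.\<close>

lemma order_charpoly_eigenvector:
  assumes u: "norm u = 1" "X *v u = e *\<^sub>R u"
  shows "order e (charpoly X) = Suc (order e (charpoly (X + outer u u)))"
proof -
  have "order e [:- (e + 1), 1:] = 0" by (simp add: order_0I)
  moreover have "order e [:- e, 1:] = 1" using order_power_n_n[of e 1] by simp
  ultimately show ?thesis
    using arg_cong[OF charpoly_deflation[OF u], of "order e"]
    by (simp add: order_mult charpoly_nonzero del: mult_pCons_left)
qed

text \<open>Algebraic multiplicity becomes geometric by deflation: \<open>e\<close> has order at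
  least 2 iff it is still an eigenvalue after deflating one eigenvector \<open>u\<close>.\<close>

lemma has_multiple_eigenvalue_iff_eigenvectors:
  assumes X: "X \<in> Sym"
  shows "has_multiple_eigenvalue X \<longleftrightarrow>
    (\<exists>e u v. norm u = 1 \<and> norm v = 1 \<and> u \<bullet> v = 0 \<and> X *v u = e *\<^sub>R u \<and> X *v v = e *\<^sub>R v)"
proof -
  have *: "order e (charpoly X) \<ge> 2 \<longleftrightarrow> (\<exists>v. norm v = 1 \<and> u \<bullet> v = 0 \<and> X *v v = e *\<^sub>R v)"
    if u: "norm u = 1" "X *v u = e *\<^sub>R u" for e u
  proof -
    have "order e (charpoly X) \<ge> 2 \<longleftrightarrow> (\<exists>v. norm v = 1 \<and> (X + outer u u) *v v = e *\<^sub>R v)"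
      by (simp add: order_charpoly_eigenvector[OF u] order_root charpoly_nonzero Suc_le_eq
          flip: root_charpoly_iff)
    moreover have "(X + outer u u) *v v = e *\<^sub>R v \<longleftrightarrow> u \<bullet> v = 0 \<and> X *v v = e *\<^sub>R v" for v
    proof
      assume eq: "(X + outer u u) *v v = e *\<^sub>R v"
      have "u \<bullet> u = 1" using u(1) by (simp add: norm_eq_1)
      \<comment> \<open>Pairing the eigenvector equation with \<open>u\<close> leaves a surplus term
        \<open>u \<bullet> v\<close>, which must be 0.\<close>
      then have "u \<bullet> ((X + outer u u) *v v) = e * (u \<bullet> v) + u \<bullet> v"
        using Sym_inner[OF X, of u v] u(2)
        by (simp add: matrix_vector_mult_add_rdistrib outer_mult_vec inner_simps)
      then have "u \<bullet> v = 0" unfolding eq by simp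
      with eq show "u \<bullet> v = 0 \<and> X *v v = e *\<^sub>R v"
        by (simp add: matrix_vector_mult_add_rdistrib outer_mult_vec)
    qed (simp add: matrix_vector_mult_add_rdistrib outer_mult_vec)
    ultimately show ?thesis by simp
  qed
  have "\<exists>u. norm u = 1 \<and> X *v u = e *\<^sub>R u" if "order e (charpoly X) \<ge> 2" for e
    using that unfolding root_charpoly_iff[symmetric] order_root by linarith
  with * show ?thesis unfolding has_multiple_eigenvalue_def by meson
qed

section \<open>A polynomial parametrization of the discriminant surface\<close>

definition gram :: "real^'n \<Rightarrow> real^'n \<Rightarrow> real" where
  "gram u v = (u \<bullet> u) * (v \<bullet> v) - (u \<bullet> v) * (u \<bullet> v)"

text \<open>The Gram determinant times the orthogonal projection onto the complement of
  \<open>u\<close>, \<open>v\<close>, written so that no division occurs.\<close>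

definition gram_proj :: "real^'n \<Rightarrow> real^'n \<Rightarrow> real^'n^'n" where
  "gram_proj u v = mat (gram u v) - (v \<bullet> v) *\<^sub>R outer u u + (u \<bullet> v) *\<^sub>R (outer u v + outer v u)
     - (u \<bullet> u) *\<^sub>R outer v v"

lemma gram_proj_mult_vec:
  "gram_proj u v *v x = gram u v *\<^sub>R x - ((v \<bullet> v) * (u \<bullet> x) - (u \<bullet> v) * (v \<bullet> x)) *\<^sub>R u
     - ((u \<bullet> u) * (v \<bullet> x) - (u \<bullet> v) * (u \<bullet> x)) *\<^sub>R v"
  by (simp add: gram_proj_def matrix_vector_mult_diff_rdistrib matrix_vector_mult_add_rdistrib
      scaleR_matrix_vector_assoc[symmetric] outer_mult_vec mat_mult_vec scalar_mult_eq_scaleR algebra_simps)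

lemma gram_proj_kernel: "gram_proj u v *v u = 0" "gram_proj u v *v v = 0"
  by (simp_all add: gram_proj_mult_vec gram_def inner_commute algebra_simps)

lemma gram_proj_Sym: "gram_proj u v \<in> Sym"
  by (auto simp: Sym_def gram_proj_def vec_eq_iff transpose_def outer_def mat_def mult.commute)

text \<open>The inner application differs from \<open>gram u v *\<^sub>R x\<close> only by multiples
  of \<open>u\<close> and \<open>v\<close>, which the outer one kills.\<close>

lemma gram_proj_idem: "gram_proj u v *v (gram_proj u v *v x) = gram u v *\<^sub>R (gram_proj u v *v x)"
  by (subst (2) gram_proj_mult_vec)
    (simp add: matrix_vector_mult_diff_distrib matrix_vector_mult_scaleR gram_proj_kernel)

text \<open>By symmetry the squared length of the image of \<open>x\<close> is the inner product of
  \<open>x\<close> with the twice applied matrix, which carries the factor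
  \<open>gram u v\<close>.\<close>

lemma gram_proj_degenerate:
  assumes "gram u v = 0"
  shows "gram_proj u v *v x = 0"
proof -
  have "(gram_proj u v *v x) \<bullet> (gram_proj u v *v x) = 0"
    unfolding Sym_inner[OF gram_proj_Sym] gram_proj_idem by (simp add: assms)
  then show ?thesis by simp
qed

definition surface_param :: "real \<Rightarrow> real^'n^'n \<Rightarrow> real^'n \<Rightarrow> real^'n \<Rightarrow> real^'n^'n" where
  "surface_param e S u v = mat e + gram_proj u v ** S ** gram_proj u v"

lemma surface_param_mult_vec:
  "surface_param e S u v *v x = e *\<^sub>R x + gram_proj u v *v (S *v (gram_proj u v *v x))"
  by (simp add: surface_param_def matrix_vector_mult_add_rdistrib mat_mult_vec scalar_mult_eq_scaleR
      flip: matrix_vector_mul_assoc)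

lemma surface_param_in_Sym:
  assumes "S \<in> Sym"
  shows "surface_param e S u v \<in> Sym"
proof -
  have "transpose (gram_proj u v ** S ** gram_proj u v) = gram_proj u v ** S ** gram_proj u v"
    using assms gram_proj_Sym[of u v] by (simp add: Sym_def matrix_transpose_mul matrix_mul_assoc)
  then show ?thesis
    by (auto simp: Sym_def surface_param_def vec_eq_iff transpose_def mat_def)
qed

lemma surface_param_multiple_eigenvalue:
  fixes u v :: "real^'n"
  assumes "CARD('n) \<ge> 2" and S: "S \<in> Sym"
  shows "has_multiple_eigenvalue (surface_param e S u v)"
proof -
  let ?X = "surface_param e S u v"
  have "\<exists>a b. norm a = 1 \<and> norm b = 1 \<and> a \<bullet> b = 0 \<and> ?X *v a = e *\<^sub>R a \<and> ?X *v b = e *\<^sub>R b"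
  proof (cases "gram u v = 0")
    case True
    \<comment> \<open>Here the matrix is \<open>e\<close> times the identity, and two distinct
      coordinate vectors, available in dimension at least 2, serve as eigenvectors.\<close>
    then have X: "?X *v x = e *\<^sub>R x" for x
      by (simp add: surface_param_mult_vec gram_proj_degenerate)
    obtain i j :: 'n where "i \<noteq> j"
      using assms(1) card_le_Suc0_iff_eq[of "UNIV :: 'n set"] by auto
    then show ?thesis
      by (intro exI[of _ "axis i 1"] exI[of _ "axis j 1"]) (simp add: X inner_axis_axis)
  next
    case False
    \<comment> \<open>Gram-Schmidt without division: \<open>w\<close> is
      \<open>u \<bullet> u\<close> times the component of \<open>v\<close> orthogonal to
      \<open>u\<close>.\<close>
    define w where "w = (u \<bullet> u) *\<^sub>R v - (u \<bullet> v) *\<^sub>R u"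
    have Xu: "?X *v u = e *\<^sub>R u" and Xv: "?X *v v = e *\<^sub>R v"
      by (simp_all add: surface_param_mult_vec gram_proj_kernel)
    have Xw: "?X *v w = e *\<^sub>R w"
      by (simp add: w_def matrix_vector_mult_diff_distrib matrix_vector_mult_scaleR Xu Xv algebra_simps)
    have "u \<noteq> 0" using False by (auto simp: gram_def)
    moreover have "v \<bullet> w = gram u v"
      by (simp add: w_def gram_def inner_simps inner_commute)
    then have "w \<noteq> 0" using False by auto
    moreover have "u \<bullet> w = 0"
      by (simp add: w_def inner_simps)
    ultimately show ?thesis
      by (intro exI[of _ "u /\<^sub>R norm u"] exI[of _ "w /\<^sub>R norm w"])
        (simp add: matrix_vector_mult_scaleR Xu Xw)
  qed
  then show ?thesis
    unfolding has_multiple_eigenvalue_iff_eigenvectors[OF surface_param_in_Sym[OF S]] by blast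
qed

text \<open>For orthonormal eigenvectors \<open>u\<close>, \<open>v\<close> the Gram determinant is
  1, so \<open>gram_proj u v\<close> is a true projection. \<open>X - mat e\<close> kills
  \<open>u\<close> and \<open>v\<close>, and by symmetry its range is orthogonal to both; so
  projecting on either side leaves it unchanged.\<close>

lemma surface_param_surj:
  assumes X: "X \<in> Sym" and "has_multiple_eigenvalue X"
  obtains e S u v where "S \<in> Sym" "X = surface_param e S u v"
proof -
  obtain e u v where uv: "norm u = 1" "norm v = 1" "u \<bullet> v = 0"
    and Xu: "X *v u = e *\<^sub>R u" and Xv: "X *v v = e *\<^sub>R v"
    using assms has_multiple_eigenvalue_iff_eigenvectors by blast
  define S where "S = X - mat e"
  have S: "S \<in> Sym"
    using X by (auto simp: S_def Sym_def vec_eq_iff transpose_def mat_def)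
  have Smv: "S *v x = X *v x - e *\<^sub>R x" for x
    by (simp add: S_def matrix_vector_mult_diff_rdistrib mat_mult_vec scalar_mult_eq_scaleR)
  have ker: "S *v u = 0" "S *v v = 0"
    by (simp_all add: Smv Xu Xv)
  have P: "gram_proj u v *v x = x - (u \<bullet> x) *\<^sub>R u - (v \<bullet> x) *\<^sub>R v" for x
    using uv by (simp add: gram_proj_mult_vec gram_def norm_eq_1)
  have "u \<bullet> (S *v x) = 0" "v \<bullet> (S *v x) = 0" for x
    by (simp_all add: ker flip: Sym_inner[OF S])
  then have "gram_proj u v *v (S *v x) = S *v x" for x
    by (simp add: P)
  moreover have "S *v (gram_proj u v *v x) = S *v x" for x
    by (simp add: P matrix_vector_mult_diff_distrib matrix_vector_mult_scaleR ker)
  ultimately have "surface_param e S u v *v x = X *v x" for x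
    by (simp add: surface_param_mult_vec) (simp add: Smv)
  then have "X = surface_param e S u v"
    by (simp add: matrix_eq)
  with S that show thesis by blast
qed

section \<open>Irreducibility\<close>

lemma polynomial_function_matrixI:
  fixes \<gamma> :: "real \<Rightarrow> real^'n^'m"
  assumes "\<And>i j. real_polynomial_function (\<lambda>t. \<gamma> t $ i $ j)"
  shows "polynomial_function \<gamma>"
  unfolding polynomial_function_iff_Basis_inner
  using assms by (auto simp: Basis_vec_def inner_axis)

lemma real_polynomial_function_surface_param_line:
  fixes S S' :: "real^'n^'n"
  assumes f: "real_polynomial_function f"
  shows "real_polynomial_function
    (\<lambda>t. f (surface_param (e + t * e') (S + t *\<^sub>R S') (u + t *\<^sub>R u') (v + t *\<^sub>R v')))"
proof -
  have id: "real_polynomial_function (\<lambda>t::real. t)"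
    by (simp add: real_polynomial_function_eq)
  have line: "real_polynomial_function (\<lambda>t. a + t * b)" for a b :: real
    by (intro real_polynomial_function.intros id)
  have inner: "real_polynomial_function (\<lambda>t. (a + t *\<^sub>R a') \<bullet> (b + t *\<^sub>R b'))"
    for a a' b b' :: "real^'n"
    by (simp add: inner_vec_def)
      (intro real_polynomial_function_sum real_polynomial_function.intros(4) line; simp)
  have mat: "real_polynomial_function (\<lambda>t. (mat (h t) :: real^'n^'n) $ i $ j)"
    if "real_polynomial_function h" for h :: "real \<Rightarrow> real" and i j
    using that by (cases "i = j") (simp_all add: mat_def real_polynomial_function.intros(2))
  have outer: "real_polynomial_function (\<lambda>t. outer (a + t *\<^sub>R a') (b + t *\<^sub>R b') $ i $ j)"
    for a a' b b' :: "real^'n" and i j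
    by (simp add: outer_def) (intro real_polynomial_function.intros(4) line)
  have proj: "real_polynomial_function (\<lambda>t. gram_proj (u + t *\<^sub>R u') (v + t *\<^sub>R v') $ i $ j)" for i j
    unfolding gram_proj_def gram_def vector_add_component vector_minus_component vector_scaleR_component
      real_scaleR_def
    by (intro real_polynomial_function_diff real_polynomial_function.intros(3,4) inner outer mat)
  have "polynomial_function
      (\<lambda>t. surface_param (e + t * e') (S + t *\<^sub>R S') (u + t *\<^sub>R u') (v + t *\<^sub>R v'))"
  proof (rule polynomial_function_matrixI)
    fix i j
    show "real_polynomial_function (\<lambda>t. surface_param (e + t * e') (S + t *\<^sub>R S')
        (u + t *\<^sub>R u') (v + t *\<^sub>R v') $ i $ j)"
      by (simp add: surface_param_def matrix_matrix_mult_def)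
        (intro real_polynomial_function_sum real_polynomial_function.intros(3,4) line mat proj; simp)
  qed
  from real_polynomial_function_compose[OF this f] show ?thesis
    by (simp add: o_def)
qed

text \<open>Passing to formal polynomials gives access to the absence of zero divisors in
  \<open>real poly\<close>.\<close>

lemma real_polynomial_function_poly:
  fixes f :: "real \<Rightarrow> real"
  assumes "real_polynomial_function f"
  obtains p where "f = poly p"
proof -
  obtain a n where "f = (\<lambda>x. \<Sum>i\<le>n. a i * x ^ i)"
    using assms real_polynomial_function_iff_sum by blast
  then have "f = poly (\<Sum>i\<le>n. monom (a i) i)"
    by (simp add: fun_eq_iff poly_sum poly_monom)
  with that show thesis by blast
qed

text \<open>Some point of \<open>M\<close> lies outside \<open>A\<close>, and one of the equations
  defining \<open>A\<close> fails there.\<close>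

lemma algebraic_in_Sym_separate:
  assumes "algebraic_in_Sym A" "A \<subseteq> M" "A \<noteq> M" "M \<subseteq> Sym"
  obtains f X where "real_polynomial_function f" "\<forall>Y\<in>A. f Y = 0" "X \<in> M" "f X \<noteq> 0"
  using assms unfolding algebraic_in_Sym_def by blast

lemma discriminant_surface_eq: "discriminant_surface = {X \<in> Sym. has_multiple_eigenvalue X}"
  unfolding discriminant_surface_def using discr_eq_0_iff by auto

lemma discriminant_surface_irreducible:
  assumes n: "CARD('n::finite) \<ge> 2"
  shows "algebraically_irreducible (discriminant_surface :: (real^'n^'n) set)"
  unfolding algebraically_irreducible_def
proof (rule notI, elim exE conjE)
  let ?M = "discriminant_surface :: (real^'n^'n) set"
  fix A B
  assume AB: "algebraic_in_Sym A" "algebraic_in_Sym B" "A \<noteq> ?M" "B \<noteq> ?M" and M: "?M = A \<union> B"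
  have MS: "?M \<subseteq> Sym" unfolding discriminant_surface_def by (rule Collect_restrict)
  have sub: "A \<subseteq> ?M" "B \<subseteq> ?M" unfolding M by simp_all
  obtain f X where f: "real_polynomial_function f" "\<forall>Y\<in>A. f Y = 0" "X \<in> ?M" "f X \<noteq> 0"
    by (rule algebraic_in_Sym_separate[OF AB(1) sub(1) AB(3) MS])
  obtain g Y where g: "real_polynomial_function g" "\<forall>Y\<in>B. g Y = 0" "Y \<in> ?M" "g Y \<noteq> 0"
    by (rule algebraic_in_Sym_separate[OF AB(2) sub(2) AB(4) MS])
  have XY: "X \<in> Sym" "has_multiple_eigenvalue X" "Y \<in> Sym" "has_multiple_eigenvalue Y"
    using f(3) g(3) unfolding discriminant_surface_eq by simp_all
  obtain e S u v where S: "S \<in> Sym" and X: "X = surface_param e S u v"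
    by (rule surface_param_surj[OF XY(1,2)])
  obtain e' S' u' v' where S': "S' \<in> Sym" and Y: "Y = surface_param e' S' u' v'"
    by (rule surface_param_surj[OF XY(3,4)])
  \<comment> \<open>The parameter line passes through the parameters of \<open>X\<close> at
    \<open>t = 0\<close> and of \<open>Y\<close> at \<open>t = 1\<close>. Its \<open>S\<close>
    component stays in the linear space \<open>Sym\<close>, so the curve never leaves the
    surface.\<close>
  define \<gamma> where "\<gamma> t = surface_param (e + t * (e' - e)) (S + t *\<^sub>R (S' - S))
    (u + t *\<^sub>R (u' - u)) (v + t *\<^sub>R (v' - v))" for t
  have \<gamma>_M: "\<gamma> t \<in> A \<union> B" for t
  proof -
    have "S + t *\<^sub>R (S' - S) \<in> Sym"
      using S S' by (simp add: Sym_def vec_eq_iff transpose_def)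
    then show ?thesis
      unfolding \<gamma>_def M[symmetric] discriminant_surface_eq
      by (simp add: surface_param_multiple_eigenvalue[OF n] surface_param_in_Sym)
  qed
  have "real_polynomial_function (\<lambda>t. f (\<gamma> t))" "real_polynomial_function (\<lambda>t. g (\<gamma> t))"
    unfolding \<gamma>_def by (intro real_polynomial_function_surface_param_line f(1) g(1))+
  then obtain p q where p: "(\<lambda>t. f (\<gamma> t)) = poly p" and q: "(\<lambda>t. g (\<gamma> t)) = poly q"
    by (elim real_polynomial_function_poly)
  \<comment> \<open>Each point of the curve lies in \<open>A\<close>, where \<open>f\<close>
    vanishes, or in \<open>B\<close>, where \<open>g\<close> does.\<close>
  have "poly (p * q) = poly 0"
  proof
    fix t
    show "poly (p * q) t = poly 0 t"
      using \<gamma>_M[of t] f(2) g(2) fun_cong[OF p, of t] fun_cong[OF q, of t] by auto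
  qed
  then have "p = 0 \<or> q = 0" by (simp only: poly_eq_poly_eq_iff mult_eq_0_iff)
  moreover have "poly p 0 \<noteq> 0"
    using f(4) fun_cong[OF p, of 0] by (simp add: X \<gamma>_def)
  moreover have "poly q 1 \<noteq> 0"
    using g(4) fun_cong[OF q, of 1] by (simp add: Y \<gamma>_def)
  ultimately show False by auto
qed

theorem mainTheorem1:
  assumes "CARD('n::finite) > 2"
  shows "(discriminant_surface :: (real ^ 'n ^ 'n) set) = {X \<in> Sym. has_multiple_eigenvalue X} \<and>
         algebraically_irreducible (discriminant_surface :: (real ^ 'n ^ 'n) set)"
  using assms by (simp add: discriminant_surface_irreducible flip: discriminant_surface_eq)

end
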